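(* Let $\mathcal{M}:\mathbf{Set}^{\mathrm{op}}\to\mathbf{Set}$ be the functor sending a set $A$ to the set of all metrics $d:A\times A\to\mathbb{R}_{\ge0}\cup\{\infty\}$, and a map $f:A\to B$ to $\mathcal{M}(B)\to\mathcal{M}(A)$, $d_B\mapsto d_A$ with $d_A(x,y):=d_B(f(x),f(y))$. Equip $\mathbf{Set}$ with the bicoverings given by cospans $A\to C\leftarrow B$ of injective maps that are jointly surjective; regard $A,B$ as subsets of $C$, so $A\cup B=C$ and $A\times_C B=A\cap B$. For such a bicovering define $g:\mathcal{M}(A)\times_{\mathcal{M}(A\cap B)}\mathcal{M}(B)\to\mathcal{M}(C)$ by $$g(d_A,d_B)(x,z)=\begin{cases}d_A(x,z)&\text{if }x\in A,\ z\in A,\\ \inf_{y\in A\cap B}[d_A(x,y)+d_B(y,z)]&\text{if }x\in A,\ z\in B,\\ \inf_{y\in A\cap B}[d_B(x,y)+d_A(y,z)]&\text{if }x\in B,\ z\in A,\\ d_B(x,z)&\text{if }x\in B,\ z\in B,\end{cases}$$ where the infima are $\infty$ if $A\cap B=\emptyset$ (the values agree where cases overlap). With these definitions, $(\mathcal{M},g)$ is a gleaf.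
   Context: **Metrics.** Here a metric on a set $A$ is a function $d:A\times A\to\mathbb{R}_{\ge0}\cup\{\infty\}$ with $d(x,x)=0$, $d(x,z)\le d(x,y)+d(y,z)$, and symmetry $d(x,y)=d(y,x)$; non-degeneracy is not required. The symmetry axiom is optional: it may be imposed throughout or dropped throughout. **Morphisms of bicoverings.** The cospans named in the claim form a system of bicoverings on $\mathbf{Set}$; the two legs are not distinguished. A morphism of bicoverings from $a'\to c'\leftarrow b'$ to $a\to c\leftarrow b$ consists of $q_a:a'\to a$, $q_b:b'\to b$, $q_c:c'\to c$ commuting with the legs, such that the induced map $a'\times_{c'}b'\to a\times_c b$ has a right inverse. **Gleaves.** A $\mathbf{Set}$-valued gleaf on a category $\mathsf{C}$ with a system of bicoverings is a functor $\Gamma:\mathsf{C}^{\mathrm{op}}\to\mathbf{Set}$ together with a map $g:\Gamma(a)\times_{\Gamma(a\times_c b)}\Gamma(b)\to\Gamma(c)$ for every bicovering $a\to c\leftarrow b$ (independent, up to swapping arguments, of the order of the legs), such that: 1. (Identity) for a bicovering $a=a\leftarrow b$, $g=\pi_1:\Gamma(a)\times_{\Gamma(b)}\Gamma(b)\to\Gamma(a)$; for a bicovering $a\to b=b$, $g=\pi_2:\Gamma(a)\times_{\Gamma(a)}\Gamma(b)\to\Gamma(b)$. 2. (Back-and-forth) given bicoverings $a\to c\leftarrow b$ and $a'\to a\leftarrow a\times_c b$, the composite $\Gamma(a')\times_{\Gamma(a'\times_c b)}\Gamma(b)\xrightarrow{g}\Gamma(c)\to\Gamma(a)\times_{\Gamma(a\times_c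 b)}\Gamma(b)\xrightarrow{g}\Gamma(c)$ (middle arrow: restriction) equals $g:\Gamma(a')\times_{\Gamma(a'\times_c b)}\Gamma(b)\to\Gamma(c)$ (for the composed bicovering $a'\to c\leftarrow b$). 3. (Partial naturality) for every morphism of bicoverings $(q_a,q_b,q_c)$ from $a'\to c'\leftarrow b'$ to $a\to c\leftarrow b$, $\Gamma(q_c)\circ g=g\circ(\Gamma(q_a)\times\Gamma(q_b))$ as maps $\Gamma(a)\times_{\Gamma(a\times_c b)}\Gamma(b)\to\Gamma(c')$. *)

theory Defs
  imports "HOL-Library.FuncSet" "HOL-Library.Extended_Nonnegative_Real"
begin

section \<open>Categories, pullbacks and systems of bicoverings\<close>

record ('o, 'm) cat =
  Obj :: "'o set"
  Arr :: "'m set"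
  Dom :: "'m \<Rightarrow> 'o"
  Cod :: "'m \<Rightarrow> 'o"
  Ident :: "'o \<Rightarrow> 'm"
  Comp :: "'m \<Rightarrow> 'm \<Rightarrow> 'm"

definition hom :: "('o, 'm) cat \<Rightarrow> 'o \<Rightarrow> 'o \<Rightarrow> 'm set" where
  "hom C a b = {f \<in> Arr C. Dom C f = a \<and> Cod C f = b}"

locale category =
  fixes C :: "('o, 'm) cat"
  assumes dom_obj: "f \<in> Arr C \<Longrightarrow> Dom C f \<in> Obj C"
    and cod_obj: "f \<in> Arr C \<Longrightarrow> Cod C f \<in> Obj C"
    and ident_hom: "a \<in> Obj C \<Longrightarrow> Ident C a \<in> hom C a a"
    and comp_hom: "f \<in> hom C a b \<Longrightarrow> g \<in> hom C b c \<Longrightarrow> Comp C g f \<in> hom C a c"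
    and ident_right: "f \<in> hom C a b \<Longrightarrow> Comp C f (Ident C a) = f"
    and ident_left: "f \<in> hom C a b \<Longrightarrow> Comp C (Ident C b) f = f"
    and comp_assoc: "f \<in> hom C a b \<Longrightarrow> g \<in> hom C b c \<Longrightarrow> h \<in> hom C c d \<Longrightarrow>
      Comp C h (Comp C g f) = Comp C (Comp C h g) f"

definition is_cospan :: "('o, 'm) cat \<Rightarrow> 'm \<Rightarrow> 'm \<Rightarrow> bool" where
  "is_cospan C i j \<longleftrightarrow> i \<in> Arr C \<and> j \<in> Arr C \<and> Cod C i = Cod C j"

definition commuting_square :: "('o, 'm) cat \<Rightarrow> 'm \<Rightarrow> 'm \<Rightarrow> 'm \<Rightarrow> 'm \<Rightarrow> bool" where
  "commuting_square C i j p q \<longleftrightarrow>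
     is_cospan C i j \<and> p \<in> Arr C \<and> q \<in> Arr C \<and> Dom C p = Dom C q \<and>
     Cod C p = Dom C i \<and> Cod C q = Dom C j \<and> Comp C i p = Comp C j q"

definition is_pullback :: "('o, 'm) cat \<Rightarrow> 'm \<Rightarrow> 'm \<Rightarrow> 'm \<Rightarrow> 'm \<Rightarrow> bool" where
  "is_pullback C i j p q \<longleftrightarrow>
     commuting_square C i j p q \<and>
     (\<forall>p' q'. commuting_square C i j p' q' \<longrightarrow>
        (\<exists>!u. u \<in> hom C (Dom C p') (Dom C p) \<and> Comp C p u = p' \<and> Comp C q u = q'))"

text \<open>
  A system of bicoverings is a symmetric set of pairs \<open>(i, j)\<close>, the legs of the cospans
  \<open>a \<rightarrow> c \<leftarrow> b\<close>. No choice of pullbacks is made: the definitions below quantify over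
  all pullbacks of a cospan.
\<close>

locale bicovering_system = category C
  for C :: "('o, 'm) cat" +
  fixes B :: "('m \<times> 'm) set"
  assumes bicov_cospan: "(i, j) \<in> B \<Longrightarrow> is_cospan C i j"
    and bicov_swap: "(i, j) \<in> B \<Longrightarrow> (j, i) \<in> B"
    and bicov_pullback: "(i, j) \<in> B \<Longrightarrow> \<exists>p q. is_pullback C i j p q"
    and bicov_compose: "(i, j) \<in> B \<Longrightarrow> is_pullback C i j p q \<Longrightarrow> (k, p) \<in> B \<Longrightarrow>
      (Comp C i k, j) \<in> B"

definition bicovering_morphism ::
  "('o, 'm) cat \<Rightarrow> 'm \<Rightarrow> 'm \<Rightarrow> 'm \<Rightarrow> 'm \<Rightarrow> 'm \<Rightarrow> 'm \<Rightarrow> 'm \<Rightarrow> bool" where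
  "bicovering_morphism C i' j' i j qa qb qc \<longleftrightarrow>
     qa \<in> hom C (Dom C i') (Dom C i) \<and>
     qb \<in> hom C (Dom C j') (Dom C j) \<and>
     qc \<in> hom C (Cod C i') (Cod C i) \<and>
     Comp C qc i' = Comp C i qa \<and>
     Comp C qc j' = Comp C j qb \<and>
     (\<exists>p' q' p q u s.
        is_pullback C i' j' p' q' \<and> is_pullback C i j p q \<and>
        u \<in> hom C (Dom C p') (Dom C p) \<and>
        Comp C p u = Comp C qa p' \<and> Comp C q u = Comp C qb q' \<and>
        s \<in> hom C (Dom C p) (Dom C p') \<and> Comp C u s = Ident C (Dom C p))"


section \<open>Gleaves\<close>

locale presheaf = category C
  for C :: "('o, 'm) cat" +
  fixes \<Gamma> :: "'o \<Rightarrow> 'x set"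
    and res :: "'m \<Rightarrow> 'x \<Rightarrow> 'x"
  assumes res_closed: "f \<in> hom C a b \<Longrightarrow> x \<in> \<Gamma> b \<Longrightarrow> res f x \<in> \<Gamma> a"
    and res_ident: "a \<in> Obj C \<Longrightarrow> x \<in> \<Gamma> a \<Longrightarrow> res (Ident C a) x = x"
    and res_comp: "f \<in> hom C a b \<Longrightarrow> g \<in> hom C b c \<Longrightarrow> x \<in> \<Gamma> c \<Longrightarrow>
      res (Comp C g f) x = res f (res g x)"

text \<open>
  The fibre product \<open>\<Gamma>(a) \<times>\<^bsub>\<Gamma>(a \<times>\<^bsub>c\<^esub> b)\<^esub> \<Gamma>(b)\<close> of a cospan
  \<open>a \<rightarrow> c \<leftarrow> b\<close> that has a pullback.
\<close>

definition compatible_pairs ::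
  "('o, 'm) cat \<Rightarrow> ('o \<Rightarrow> 'x set) \<Rightarrow> ('m \<Rightarrow> 'x \<Rightarrow> 'x) \<Rightarrow> 'm \<Rightarrow> 'm \<Rightarrow> ('x \<times> 'x) set" where
  "compatible_pairs C \<Gamma> res i j =
     {(x, y). x \<in> \<Gamma> (Dom C i) \<and> y \<in> \<Gamma> (Dom C j) \<and>
              (\<forall>p q. is_pullback C i j p q \<longrightarrow> res p x = res q y)}"

locale gleaf = bicovering_system C B + presheaf C \<Gamma> res
  for C :: "('o, 'm) cat"
    and B :: "('m \<times> 'm) set"
    and \<Gamma> :: "'o \<Rightarrow> 'x set"
    and res :: "'m \<Rightarrow> 'x \<Rightarrow> 'x" +
  fixes g :: "'m \<Rightarrow> 'm \<Rightarrow> 'x \<times> 'x \<Rightarrow> 'x"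
  assumes glue_closed:
      "(i, j) \<in> B \<Longrightarrow> xy \<in> compatible_pairs C \<Gamma> res i j \<Longrightarrow> g i j xy \<in> \<Gamma> (Cod C i)"
    and glue_swap:
      "(i, j) \<in> B \<Longrightarrow> (x, y) \<in> compatible_pairs C \<Gamma> res i j \<Longrightarrow> g j i (y, x) = g i j (x, y)"
    and identity_left:
      "a \<in> Obj C \<Longrightarrow> (Ident C a, j) \<in> B \<Longrightarrow>
       (x, y) \<in> compatible_pairs C \<Gamma> res (Ident C a) j \<Longrightarrow> g (Ident C a) j (x, y) = x"
    and identity_right:
      "b \<in> Obj C \<Longrightarrow> (i, Ident C b) \<in> B \<Longrightarrow>
       (x, y) \<in> compatible_pairs C \<Gamma> res i (Ident C b) \<Longrightarrow> g i (Ident C b) (x, y) = y"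
    and back_and_forth:
      "(i, j) \<in> B \<Longrightarrow> is_pullback C i j p q \<Longrightarrow> (k, p) \<in> B \<Longrightarrow>
       xy \<in> compatible_pairs C \<Gamma> res (Comp C i k) j \<Longrightarrow>
       g i j (res i (g (Comp C i k) j xy), res j (g (Comp C i k) j xy)) = g (Comp C i k) j xy"
    and partial_naturality:
      "(i', j') \<in> B \<Longrightarrow> (i, j) \<in> B \<Longrightarrow> bicovering_morphism C i' j' i j qa qb qc \<Longrightarrow>
       (x, y) \<in> compatible_pairs C \<Gamma> res i j \<Longrightarrow>
       res qc (g i j (x, y)) = g i' j' (res qa x, res qb y)"


section \<open>The category of sets and its bicoverings\<close>

text \<open>
  The sets are the subsets of an arbitrary type \<open>'u\<close>. A map is a triple
  \<open>(A, f, B)\<close> where \<open>f\<close> takes the value \<^const>\<open>undefined\<close> outside \<open>A\<close>, so that equality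
  of triples is equality of maps.
\<close>

type_synonym 'u set_map = "'u set \<times> ('u \<Rightarrow> 'u) \<times> 'u set"

definition map_fun_of :: "'u set_map \<Rightarrow> 'u \<Rightarrow> 'u" where
  "map_fun_of m = fst (snd m)"

definition set_cat :: "('u set, 'u set_map) cat" where
  "set_cat = \<lparr>
     Obj = UNIV,
     Arr = {(A, f, B) | A f B. f \<in> A \<rightarrow>\<^sub>E B},
     Dom = (\<lambda>(A, f, B). A),
     Cod = (\<lambda>(A, f, B). B),
     Ident = (\<lambda>A. (A, (\<lambda>x\<in>A. x), A)),
     Comp = (\<lambda>(A', g, B') (A, f, B). (A, compose A g f, B')) \<rparr>"

definition image_of :: "'u set_map \<Rightarrow> 'u set" where
  "image_of m = map_fun_of m ` Dom set_cat m"

definition set_bicoverings :: "('u set_map \<times> 'u set_map) set" where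
  "set_bicoverings =
     {(i, j). is_cospan set_cat i j \<and>
              inj_on (map_fun_of i) (Dom set_cat i) \<and>
              inj_on (map_fun_of j) (Dom set_cat j) \<and>
              image_of i \<union> image_of j = Cod set_cat i}"


section \<open>Metrics\<close>

text \<open>The flag \<open>symm\<close> says whether the symmetry axiom is imposed.\<close>

definition metrics :: "bool \<Rightarrow> 'u set \<Rightarrow> ('u \<times> 'u \<Rightarrow> ennreal) set" where
  "metrics symm A =
     {d \<in> extensional (A \<times> A).
        (\<forall>x\<in>A. d (x, x) = 0) \<and>
        (\<forall>x\<in>A. \<forall>y\<in>A. \<forall>z\<in>A. d (x, z) \<le> d (x, y) + d (y, z)) \<and>
        (symm \<longrightarrow> (\<forall>x\<in>A. \<forall>y\<in>A. d (x, y) = d (y, x)))}"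

definition metric_res :: "'u set_map \<Rightarrow> ('u \<times> 'u \<Rightarrow> ennreal) \<Rightarrow> ('u \<times> 'u \<Rightarrow> ennreal)" where
  "metric_res m d =
     (\<lambda>(x, y) \<in> Dom set_cat m \<times> Dom set_cat m. d (map_fun_of m x, map_fun_of m y))"

text \<open>
  For an injective \<open>i : A \<rightarrow> C\<close>, the function \<open>on_image i d\<close> is \<open>d\<close> read on the subset
  \<^term>\<open>image_of i\<close> of \<open>C\<close>, with which \<open>A\<close> is identified.
\<close>

definition on_image :: "'u set_map \<Rightarrow> ('u \<times> 'u \<Rightarrow> ennreal) \<Rightarrow> 'u \<Rightarrow> 'u \<Rightarrow> ennreal" where
  "on_image i d x y =
     d (inv_into (Dom set_cat i) (map_fun_of i) x, inv_into (Dom set_cat i) (map_fun_of i) y)"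

definition inf_through ::
  "'u set_map \<Rightarrow> 'u set_map \<Rightarrow> ('u \<times> 'u \<Rightarrow> ennreal) \<Rightarrow> ('u \<times> 'u \<Rightarrow> ennreal) \<Rightarrow> 'u \<Rightarrow> 'u \<Rightarrow> ennreal" where
  "inf_through i j d e x z =
     (INF y \<in> image_of i \<inter> image_of j. on_image i d x y + on_image j e y z)"

definition metric_glue ::
  "'u set_map \<Rightarrow> 'u set_map \<Rightarrow> ('u \<times> 'u \<Rightarrow> ennreal) \<times> ('u \<times> 'u \<Rightarrow> ennreal) \<Rightarrow>
   ('u \<times> 'u \<Rightarrow> ennreal)" where
  "metric_glue i j = (\<lambda>(dA, dB). \<lambda>(x, z) \<in> Cod set_cat i \<times> Cod set_cat i.
     if x \<in> image_of i \<and> z \<in> image_of i then on_image i dA x z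
     else if x \<in> image_of i \<and> z \<in> image_of j then inf_through i j dA dB x z
     else if x \<in> image_of j \<and> z \<in> image_of i then inf_through j i dB dA x z
     else on_image j dB x z)"

text \<open>
  The four cases of \<^const>\<open>metric_glue\<close> overlap; on compatible pairs each of the four formulas
  holds on the whole of its case.
\<close>

definition metric_glue_consistent :: "bool \<Rightarrow> 'u itself \<Rightarrow> bool" where
  "metric_glue_consistent symm _ \<longleftrightarrow>
     (\<forall>(i :: 'u set_map, j) \<in> set_bicoverings.
      \<forall>(dA, dB) \<in> compatible_pairs set_cat (metrics symm) metric_res i j. \<forall>x z.
        (x \<in> image_of i \<and> z \<in> image_of i \<longrightarrow>
           metric_glue i j (dA, dB) (x, z) = on_image i dA x z) \<and>
        (x \<in> image_of i \<and> z \<in> image_of j \<longrightarrow>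
           metric_glue i j (dA, dB) (x, z) = inf_through i j dA dB x z) \<and>
        (x \<in> image_of j \<and> z \<in> image_of i \<longrightarrow>
           metric_glue i j (dA, dB) (x, z) = inf_through j i dB dA x z) \<and>
        (x \<in> image_of j \<and> z \<in> image_of j \<longrightarrow>
           metric_glue i j (dA, dB) (x, z) = on_image j dB x z))"

end

theory Submission
  imports Defs
begin

text \<open>
  The glued distance is the infimum of the lengths of all paths that move freely inside \<open>A\<close> and
  inside \<open>B\<close> and change sides only in \<open>A \<inter> B\<close>. One change of sides always suffices: an excursion
  from \<open>A\<close> into \<open>B\<close> and back enters and leaves through \<open>A \<inter> B\<close>, where both distances agree,
  so the triangle inequality in \<open>A\<close> shows that it does not shorten the path. This
  is why the single infimum over \<open>A \<inter> B\<close> already satisfies the triangle inequality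
  (\<open>glued_distance\<close>) and why the overlapping cases of its definition agree (\<open>glued_left\<close>,
  \<open>glued_left_right\<close>, \<open>glued_right_left\<close>, \<open>glued_right\<close>).

  Given this, two of the gleaf laws compare infima over different overlaps. In the back-and-forth
  law the smaller overlap \<open>A' \<inter> B\<close> already attains the lower bound that the triangle inequality
  imposes on every infimum over the larger \<open>A \<inter> B\<close>, and the points of \<open>A\<close> outside \<open>A'\<close>
  lie in \<open>B\<close> (\<open>image_of_bicovered_leg\<close>), so that a path may change sides right there. For partial
  naturality, the right inverse of the map between the pullbacks says precisely that the overlap
  upstairs maps onto the overlap downstairs (\<open>bicovering_morphism_overlap\<close>), so both
  infima range over the same values.

  The metric arguments are carried out for two overlapping subsets \<open>P\<close>, \<open>Q\<close> of one type.
  A bicovering is reduced to this situation by reading the metrics on the images of its injective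
  legs. Any pullback of the legs, whichever one is given, has the intersection of the two images as
  its image (\<open>image_of_pullback\<close>), and so stands for \<open>A \<inter> B\<close>.
\<close>

section \<open>Gluing two distances along an intersection\<close>

definition distance_on :: "bool \<Rightarrow> 'a set \<Rightarrow> ('a \<Rightarrow> 'a \<Rightarrow> ennreal) \<Rightarrow> bool" where
  "distance_on symm P a \<longleftrightarrow>
     (\<forall>x\<in>P. a x x = 0) \<and>
     (\<forall>x\<in>P. \<forall>y\<in>P. \<forall>z\<in>P. a x z \<le> a x y + a y z) \<and>
     (symm \<longrightarrow> (\<forall>x\<in>P. \<forall>y\<in>P. a x y = a y x))"

definition through :: "'a set \<Rightarrow> ('a \<Rightarrow> 'a \<Rightarrow> ennreal) \<Rightarrow> ('a \<Rightarrow> 'a \<Rightarrow> ennreal) \<Rightarrow> 'a \<Rightarrow> 'a \<Rightarrow> ennreal" where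
  "through D a b x z = (INF y\<in>D. a x y + b y z)"

definition glued :: "'a set \<Rightarrow> 'a set \<Rightarrow> ('a \<Rightarrow> 'a \<Rightarrow> ennreal) \<Rightarrow> ('a \<Rightarrow> 'a \<Rightarrow> ennreal) \<Rightarrow> 'a \<Rightarrow> 'a \<Rightarrow> ennreal" where
  "glued P Q a b x z =
     (if x \<in> P \<and> z \<in> P then a x z
      else if x \<in> P \<and> z \<in> Q then through (P \<inter> Q) a b x z
      else if x \<in> Q \<and> z \<in> P then through (P \<inter> Q) b a x z
      else b x z)"

lemma distance_on_self: "distance_on symm P a \<Longrightarrow> x \<in> P \<Longrightarrow> a x x = 0"
  by (simp add: distance_on_def)

lemma distance_on_triangle:
  "distance_on symm P a \<Longrightarrow> x \<in> P \<Longrightarrow> y \<in> P \<Longrightarrow> z \<in> P \<Longrightarrow> a x z \<le> a x y + a y z"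
  by (simp add: distance_on_def)

lemma distance_on_sym:
  "distance_on symm P a \<Longrightarrow> symm \<Longrightarrow> x \<in> P \<Longrightarrow> y \<in> P \<Longrightarrow> a x y = a y x"
  by (simp add: distance_on_def)

lemma through_le: "w \<in> D \<Longrightarrow> through D a b x z \<le> a x w + b w z"
  unfolding through_def by (rule INF_lower)

text \<open>
  Cancelling \<open>c\<close> moves the bound inside the infimum; for \<open>c = \<infinity>\<close> there is nothing to
  prove. The statement includes an empty \<open>D\<close>, where the infimum is \<open>\<infinity>\<close>.
\<close>

lemma le_add_INF:
  fixes t c :: ennreal
  assumes "\<And>w. w \<in> D \<Longrightarrow> t \<le> c + f w"
  shows "t \<le> c + (INF w\<in>D. f w)"
proof (cases "c = top")
  case False
  have "t - c \<le> (INF w\<in>D. f w)"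
    using assms False by (intro INF_greatest) (simp add: ennreal_minus_le_iff)
  then show ?thesis
    using False by (simp add: ennreal_minus_le_iff)
qed simp

lemma le_add_through:
  "(\<And>w. w \<in> D \<Longrightarrow> t \<le> c + (a x w + b w z)) \<Longrightarrow> t \<le> c + through D a b x z"
  unfolding through_def by (rule le_add_INF)

lemma le_through_add:
  "(\<And>w. w \<in> D \<Longrightarrow> t \<le> a x w + b w z + c) \<Longrightarrow> t \<le> through D a b x z + c"
  unfolding through_def by (subst add.commute, rule le_add_INF) (simp add: add.commute)

locale overlapping_distances =
  fixes symm :: bool and P Q :: "'a set" and a b :: "'a \<Rightarrow> 'a \<Rightarrow> ennreal"
  assumes left: "distance_on symm P a"
    and right: "distance_on symm Q b"
    and agree: "x \<in> P \<Longrightarrow> x \<in> Q \<Longrightarrow> y \<in> P \<Longrightarrow> y \<in> Q \<Longrightarrow> a x y = b x y"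
begin

text \<open>
  The situation is symmetric in its two sides, so each fact about paths that start in \<open>P\<close> has a
  mirror image, obtained by interpreting the locale a second time.
\<close>

lemma flip: "overlapping_distances symm Q P b a"
  by unfold_locales (use left right agree in auto)

text \<open>
  A path to a point \<open>z\<close> of the overlap may change sides at \<open>z\<close> itself, at no cost; changing
  sides earlier does not help, because its last part can be measured by \<open>a\<close> as well.
  This is what makes the overlapping cases of \<^const>\<open>glued\<close> agree.
\<close>

lemma through_to_overlap:
  assumes "x \<in> P" "z \<in> P" "z \<in> Q"
  shows "through (P \<inter> Q) a b x z = a x z"
proof (rule antisym)
  show "through (P \<inter> Q) a b x z \<le> a x z"
    using through_le[of z "P \<inter> Q" a b x z] assms distance_on_self[OF right] by simp
  show "a x z \<le> through (P \<inter> Q) a b x z"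
    unfolding through_def
  proof (rule INF_greatest)
    fix y assume "y \<in> P \<inter> Q"
    then show "a x z \<le> a x y + b y z"
      using distance_on_triangle[OF left, of x y z] agree[of y z] assms by simp
  qed
qed

lemma through_from_overlap:
  assumes "x \<in> P" "x \<in> Q" "z \<in> Q"
  shows "through (P \<inter> Q) a b x z = b x z"
proof (rule antisym)
  show "through (P \<inter> Q) a b x z \<le> b x z"
    using through_le[of x "P \<inter> Q" a b x z] assms distance_on_self[OF left] by simp
  show "b x z \<le> through (P \<inter> Q) a b x z"
    unfolding through_def
  proof (rule INF_greatest)
    fix y assume "y \<in> P \<inter> Q"
    then show "b x z \<le> a x y + b y z"
      using distance_on_triangle[OF right, of x y z] agree[of x y] assms by simp
  qed
qed

lemma glued_left: "x \<in> P \<Longrightarrow> z \<in> P \<Longrightarrow> glued P Q a b x z = a x z"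
  by (simp add: glued_def)

lemma glued_left_right:
  "x \<in> P \<Longrightarrow> z \<in> Q \<Longrightarrow> glued P Q a b x z = through (P \<inter> Q) a b x z"
  by (simp add: glued_def through_to_overlap)

lemma glued_right_left:
  assumes "x \<in> Q" "z \<in> P"
  shows "glued P Q a b x z = through (P \<inter> Q) b a x z"
proof -
  interpret flipped: overlapping_distances symm Q P b a
    by (rule flip)
  show ?thesis
    using assms flipped.through_to_overlap flipped.through_from_overlap
      through_to_overlap through_from_overlap
    by (auto simp: glued_def agree Int_commute)
qed

lemma glued_right:
  assumes "x \<in> Q" "z \<in> Q"
  shows "glued P Q a b x z = b x z"
proof -
  interpret flipped: overlapping_distances symm Q P b a
    by (rule flip)
  show ?thesis
    using assms flipped.through_to_overlap through_from_overlap
    by (auto simp: glued_def agree Int_commute)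
qed

lemma glued_flip:
  assumes "x \<in> P \<union> Q" "z \<in> P \<union> Q"
  shows "glued Q P b a x z = glued P Q a b x z"
proof -
  interpret flipped: overlapping_distances symm Q P b a
    by (rule flip)
  show ?thesis
    using assms
    by (auto simp: glued_left glued_right glued_left_right glued_right_left
        flipped.glued_left flipped.glued_right flipped.glued_left_right flipped.glued_right_left
        Int_commute)
qed

text \<open>
  If \<open>x\<close> and \<open>z\<close> lie on different sides, the point where the path through \<open>y\<close> changes sides is
  also a competitor for the path from \<open>x\<close> to \<open>z\<close>. The case that needs the agreement of the
  distances is \<open>x, z \<in> P\<close>, \<open>y \<in> Q\<close>: the path crosses the overlap at \<open>w\<close> and again at \<open>v\<close>, and its detour from
  \<open>w\<close> to \<open>v\<close> through \<open>y\<close> is at least \<open>b w v = a w v\<close>.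
\<close>

lemma glued_triangle_from_left:
  assumes "x \<in> P" "y \<in> P \<union> Q" "z \<in> P \<union> Q"
  shows "glued P Q a b x z \<le> glued P Q a b x y + glued P Q a b y z"
proof -
  consider "y \<in> P" "z \<in> P" | "y \<in> P" "z \<in> Q" | "y \<in> Q" "z \<in> P" | "y \<in> Q" "z \<in> Q"
    using assms by blast
  then show ?thesis
  proof cases
    case 1
    then show ?thesis
      using assms distance_on_triangle[OF left] by (simp add: glued_left)
  next
    case 2
    have "through (P \<inter> Q) a b x z \<le> a x y + through (P \<inter> Q) a b y z"
    proof (rule le_add_through)
      fix w assume w: "w \<in> P \<inter> Q"
      have "through (P \<inter> Q) a b x z \<le> a x w + b w z"
        using w by (rule through_le)
      also have "\<dots> \<le> (a x y + a y w) + b w z"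
        using w 2 assms by (intro add_mono distance_on_triangle[OF left]) auto
      finally show "through (P \<inter> Q) a b x z \<le> a x y + (a y w + b w z)"
        by (simp add: add.assoc)
    qed
    then show ?thesis
      using 2 assms by (simp add: glued_left glued_left_right)
  next
    case 3
    have "a x z \<le> through (P \<inter> Q) a b x y + through (P \<inter> Q) b a y z"
    proof (rule le_through_add, rule le_add_through)
      fix w v assume w: "w \<in> P \<inter> Q" and v: "v \<in> P \<inter> Q"
      have "a x z \<le> a x w + (a w v + a v z)"
        using w v 3 assms
        by (intro order_trans[OF distance_on_triangle[OF left, of x w z]]
            add_mono distance_on_triangle[OF left]) auto
      also have "\<dots> \<le> a x w + ((b w y + b y v) + a v z)"
        using w v 3 agree[of w v] distance_on_triangle[OF right, of w y v]
        by (intro add_mono) auto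
      finally show "a x z \<le> a x w + b w y + (b y v + a v z)"
        by (simp add: add.assoc)
    qed
    then show ?thesis
      using 3 assms by (simp add: glued_left glued_left_right glued_right_left)
  next
    case 4
    have "through (P \<inter> Q) a b x z \<le> through (P \<inter> Q) a b x y + b y z"
    proof (rule le_through_add)
      fix w assume w: "w \<in> P \<inter> Q"
      have "through (P \<inter> Q) a b x z \<le> a x w + b w z"
        using w by (rule through_le)
      also have "\<dots> \<le> a x w + (b w y + b y z)"
        using w 4 assms by (intro add_mono distance_on_triangle[OF right]) auto
      finally show "through (P \<inter> Q) a b x z \<le> a x w + b w y + b y z"
        by (simp add: add.assoc)
    qed
    then show ?thesis
      using 4 assms by (simp add: glued_right glued_left_right)
  qed
qed

lemma glued_triangle:
  assumes "x \<in> P \<union> Q" "y \<in> P \<union> Q" "z \<in> P \<union> Q"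
  shows "glued P Q a b x z \<le> glued P Q a b x y + glued P Q a b y z"
proof (cases "x \<in> P")
  case True
  then show ?thesis
    using assms by (intro glued_triangle_from_left)
next
  case False
  interpret flipped: overlapping_distances symm Q P b a
    by (rule flip)
  show ?thesis
    using flipped.glued_triangle_from_left[of x y z] False assms
    by (simp add: glued_flip Un_commute)
qed

lemma glued_sym:
  assumes "symm" "x \<in> P \<union> Q" "z \<in> P \<union> Q"
  shows "glued P Q a b x z = glued P Q a b z x"
proof -
  have *: "through (P \<inter> Q) a b x z = through (P \<inter> Q) b a z x" if "x \<in> P" "z \<in> Q" for x z
    unfolding through_def
    using that \<open>symm\<close> distance_on_sym[OF left] distance_on_sym[OF right]
    by (intro INF_cong) (auto simp: add.commute)
  show ?thesis
    using assms * distance_on_sym[OF left] distance_on_sym[OF right]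
    by (auto simp: glued_left glued_right glued_left_right glued_right_left)
qed

lemma glued_distance: "distance_on symm (P \<union> Q) (glued P Q a b)"
  unfolding distance_on_def
  using glued_triangle glued_sym distance_on_self[OF left] distance_on_self[OF right]
  by (auto simp: glued_left glued_right)

end

text \<open>
  A distance on \<open>P \<union> Q\<close> is recovered from its two restrictions as soon as it is, between points
  of different sides, not smaller than the cost of passing through the overlap; the opposite inequality is the triangle inequality.
\<close>

lemma glued_restrictions:
  assumes d: "distance_on symm (P \<union> Q) d"
    and between: "\<And>x z. x \<in> P \<Longrightarrow> z \<in> Q \<Longrightarrow> through (P \<inter> Q) d d x z \<le> d x z"
    and between': "\<And>x z. x \<in> Q \<Longrightarrow> z \<in> P \<Longrightarrow> through (P \<inter> Q) d d x z \<le> d x z"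
    and "x \<in> P \<union> Q" "z \<in> P \<union> Q"
  shows "glued P Q d d x z = d x z"
proof -
  have "d x z \<le> through (P \<inter> Q) d d x z"
    unfolding through_def using assms(4,5)
    by (intro INF_greatest distance_on_triangle[OF d]) auto
  then show ?thesis
    using assms(4,5) between[of x z] between'[of x z] by (auto simp: glued_def intro!: antisym)
qed

lemma through_cong:
  "(\<And>y. y \<in> D \<Longrightarrow> a x y = a' x' y) \<Longrightarrow> (\<And>y. y \<in> D \<Longrightarrow> b y z = b' y z') \<Longrightarrow>
   through D a b x z = through D a' b' x' z'"
  unfolding through_def by (intro INF_cong) auto

lemma through_antimono: "D \<subseteq> E \<Longrightarrow> through E a b x z \<le> through D a b x z"
  unfolding through_def by (rule INF_superset_mono) auto

lemma through_image:
  "through (f ` D) a b (f x) (f z) = through D (\<lambda>x y. a (f x) (f y)) (\<lambda>x y. b (f x) (f y)) x z"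
  by (simp add: through_def image_comp comp_def)

lemma glued_cong:
  assumes "\<And>x z. x \<in> P \<Longrightarrow> z \<in> P \<Longrightarrow> a x z = a' x z"
    and "\<And>x z. x \<in> Q \<Longrightarrow> z \<in> Q \<Longrightarrow> b x z = b' x z"
    and "x \<in> P \<union> Q" "z \<in> P \<union> Q"
  shows "glued P Q a b x z = glued P Q a' b' x z"
  using assms by (auto simp: glued_def intro!: through_cong)

text \<open>
  Gluing commutes with pulling back along \<open>f\<close> provided that the overlap upstairs covers the one
  downstairs. Otherwise \<open>P \<inter> Q\<close> may contain shortcuts that no point of \<open>P' \<inter> Q'\<close> provides.
\<close>

lemma (in overlapping_distances) glued_inverse_image:
  assumes "f ` P' \<subseteq> P" "f ` Q' \<subseteq> Q" and overlap: "f ` (P' \<inter> Q') = P \<inter> Q"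
    and "x \<in> P' \<union> Q'" "z \<in> P' \<union> Q'"
  shows "glued P' Q' (\<lambda>x z. a (f x) (f z)) (\<lambda>x z. b (f x) (f z)) x z = glued P Q a b (f x) (f z)"
proof -
  have through: "through (P \<inter> Q) a b (f x) (f z) =
      through (P' \<inter> Q') (\<lambda>x z. a (f x) (f z)) (\<lambda>x z. b (f x) (f z)) x z"
    "through (P \<inter> Q) b a (f x) (f z) =
      through (P' \<inter> Q') (\<lambda>x z. b (f x) (f z)) (\<lambda>x z. a (f x) (f z)) x z" for x z
    unfolding overlap[symmetric] by (rule through_image)+
  have PQ: "y \<in> P' \<Longrightarrow> f y \<in> P" "y \<in> Q' \<Longrightarrow> f y \<in> Q" for y
    using assms(1,2) by auto
  consider "x \<in> P'" "z \<in> P'" | "x \<in> P'" "z \<in> Q'" "z \<notin> P'"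
    | "x \<in> Q'" "z \<in> P'" "x \<notin> P'" | "x \<in> Q'" "z \<in> Q'" "x \<notin> P'" "z \<notin> P'"
    using assms(4,5) by blast
  then show ?thesis
  proof cases
    case 1
    then have "glued P Q a b (f x) (f z) = a (f x) (f z)"
      by (intro glued_left PQ)
    with 1 show ?thesis by (simp add: glued_def)
  next
    case 2
    then have "glued P Q a b (f x) (f z) = through (P \<inter> Q) a b (f x) (f z)"
      by (intro glued_left_right PQ)
    with 2 show ?thesis by (simp add: glued_def through)
  next
    case 3
    then have "glued P Q a b (f x) (f z) = through (P \<inter> Q) b a (f x) (f z)"
      by (intro glued_right_left PQ)
    with 3 show ?thesis by (simp add: glued_def through)
  next
    case 4
    then have "glued P Q a b (f x) (f z) = b (f x) (f z)"
      by (intro glued_right PQ)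
    with 4 show ?thesis by (simp add: glued_def)
  qed
qed

section \<open>The category of subsets of a type\<close>

lemma set_cat_simps [simp]:
  "Obj set_cat = UNIV"
  "Dom set_cat (A, f, B) = A"
  "Cod set_cat (A, f, B) = B"
  "map_fun_of (A, f, B) = f"
  "(A, f, B) \<in> Arr set_cat \<longleftrightarrow> f \<in> A \<rightarrow>\<^sub>E B"
  "Ident set_cat A = (A, (\<lambda>x\<in>A. x), A)"
  "Dom set_cat (Comp set_cat n m) = Dom set_cat m"
  "Cod set_cat (Comp set_cat n m) = Cod set_cat n"
  "x \<in> Dom set_cat m \<Longrightarrow> map_fun_of (Comp set_cat n m) x = map_fun_of n (map_fun_of m x)"
  by (auto simp: set_cat_def map_fun_of_def compose_def split: prod.splits)

lemma Comp_set_cat: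
  "Comp set_cat (A', g, B') (A, f, B) = (A, compose A g f, B')"
  by (simp add: set_cat_def)

lemma map_fun_of_in_Cod:
  "m \<in> Arr set_cat \<Longrightarrow> x \<in> Dom set_cat m \<Longrightarrow> map_fun_of m x \<in> Cod set_cat m"
  by (cases m) auto

lemma set_map_eqI:
  assumes "m \<in> Arr set_cat" "n \<in> Arr set_cat"
    and "Dom set_cat m = Dom set_cat n" "Cod set_cat m = Cod set_cat n"
    and "\<And>x. x \<in> Dom set_cat m \<Longrightarrow> map_fun_of m x = map_fun_of n x"
  shows "m = n"
  using assms by (cases m; cases n) (auto intro: PiE_ext)

lemma Comp_in_Arr:
  "m \<in> Arr set_cat \<Longrightarrow> n \<in> Arr set_cat \<Longrightarrow> Cod set_cat m = Dom set_cat n \<Longrightarrow>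
   Comp set_cat n m \<in> Arr set_cat"
  by (cases m; cases n) (auto simp: Comp_set_cat compose_def)

interpretation set_cat: category "set_cat :: ('u set, 'u set_map) cat"
proof
  fix a b c d :: "'u set" and f g h :: "'u set_map"
  show "Ident set_cat a \<in> hom set_cat a a"
    by (auto simp: hom_def)
  assume f: "f \<in> hom set_cat a b"
  show "Comp set_cat f (Ident set_cat a) = f" "Comp set_cat (Ident set_cat b) f = f"
    using f unfolding hom_def
    by (auto intro!: set_map_eqI Comp_in_Arr dest: map_fun_of_in_Cod)
  assume g: "g \<in> hom set_cat b c"
  show gf: "Comp set_cat g f \<in> hom set_cat a c"
    using f g by (auto simp: hom_def Comp_in_Arr)
  assume h: "h \<in> hom set_cat c d"
  show "Comp set_cat h (Comp set_cat g f) = Comp set_cat (Comp set_cat h g) f"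
    using f g h by (intro set_map_eqI) (auto simp: hom_def map_fun_of_in_Cod intro!: Comp_in_Arr)
qed auto

lemma image_of_Comp:
  "image_of (Comp set_cat n m) = map_fun_of n ` image_of m"
  by (auto simp: image_of_def)

lemma map_fun_of_Comp_eqD:
  "Comp set_cat n m = Comp set_cat n' m' \<Longrightarrow> x \<in> Dom set_cat m \<Longrightarrow>
   map_fun_of n (map_fun_of m x) = map_fun_of n' (map_fun_of m' x)"
  by (metis set_cat_simps(7,9))

lemma commuting_square_point:
  assumes "is_cospan set_cat i j" "x \<in> Dom set_cat i" "y \<in> Dom set_cat j"
    and "map_fun_of i x = map_fun_of j y"
  shows "commuting_square set_cat i j
    ({x}, (\<lambda>_\<in>{x}. x), Dom set_cat i) ({x}, (\<lambda>_\<in>{x}. y), Dom set_cat j)"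
  using assms unfolding commuting_square_def is_cospan_def
  by (auto intro!: set_map_eqI Comp_in_Arr)

text \<open>
  The universal property, tested on the one-point set \<open>{x}\<close>, shows that every pullback reaches
  every pair of points with a common image.
\<close>

lemma pullback_covers_fibre_product:
  assumes "is_pullback set_cat i j p q"
    and "x \<in> Dom set_cat i" "y \<in> Dom set_cat j" "map_fun_of i x = map_fun_of j y"
  obtains w where "w \<in> Dom set_cat p" "map_fun_of p w = x" "map_fun_of q w = y"
proof -
  let ?p = "({x}, (\<lambda>_\<in>{x}. x), Dom set_cat i)" and ?q = "({x}, (\<lambda>_\<in>{x}. y), Dom set_cat j)"
  have "is_cospan set_cat i j"
    using assms(1) by (simp add: is_pullback_def commuting_square_def)
  then obtain u where u: "u \<in> hom set_cat {x} (Dom set_cat p)"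
    "Comp set_cat p u = ?p" "Comp set_cat q u = ?q"
    using assms commuting_square_point[of i j x y]
    unfolding is_pullback_def by (metis set_cat_simps(2))
  have x: "x \<in> Dom set_cat u"
    using u(1) by (simp add: hom_def)
  show thesis
  proof
    show "map_fun_of u x \<in> Dom set_cat p"
      using u(1) x map_fun_of_in_Cod[of u x] by (simp add: hom_def)
    show "map_fun_of p (map_fun_of u x) = x" "map_fun_of q (map_fun_of u x) = y"
      using arg_cong[OF u(2), of "\<lambda>m. map_fun_of m x"] arg_cong[OF u(3), of "\<lambda>m. map_fun_of m x"] x
      by simp_all
  qed
qed

lemma commuting_square_apply:
  assumes "commuting_square set_cat i j p q" "w \<in> Dom set_cat p"
  shows "map_fun_of p w \<in> Dom set_cat i" "map_fun_of q w \<in> Dom set_cat j"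
    "map_fun_of i (map_fun_of p w) = map_fun_of j (map_fun_of q w)"
proof -
  have sq: "p \<in> Arr set_cat" "q \<in> Arr set_cat" "Dom set_cat p = Dom set_cat q"
    "Cod set_cat p = Dom set_cat i" "Cod set_cat q = Dom set_cat j"
    "Comp set_cat i p = Comp set_cat j q"
    using assms(1) by (simp_all add: commuting_square_def)
  show "map_fun_of p w \<in> Dom set_cat i" "map_fun_of q w \<in> Dom set_cat j"
    using map_fun_of_in_Cod[OF sq(1), of w] map_fun_of_in_Cod[OF sq(2), of w] sq assms(2)
    by simp_all
  show "map_fun_of i (map_fun_of p w) = map_fun_of j (map_fun_of q w)"
    using sq(6) assms(2) by (rule map_fun_of_Comp_eqD)
qed

lemma pullback_commutes:
  assumes "is_pullback set_cat i j p q" "w \<in> Dom set_cat p"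
  shows "map_fun_of p w \<in> Dom set_cat i" "map_fun_of q w \<in> Dom set_cat j"
    "map_fun_of i (map_fun_of p w) = map_fun_of j (map_fun_of q w)"
  using assms(2) commuting_square_apply[OF conjunct1[OF assms(1)[unfolded is_pullback_def]]]
  by simp_all

lemma image_of_pullback:
  assumes "is_pullback set_cat i j p q"
  shows "map_fun_of i ` image_of p = image_of i \<inter> image_of j"
proof
  show "map_fun_of i ` image_of p \<subseteq> image_of i \<inter> image_of j"
    using pullback_commutes[OF assms] by (auto simp: image_of_def)
  show "image_of i \<inter> image_of j \<subseteq> map_fun_of i ` image_of p"
  proof
    fix c assume "c \<in> image_of i \<inter> image_of j"
    then obtain x y where "x \<in> Dom set_cat i" "y \<in> Dom set_cat j"
      "c = map_fun_of i x" "map_fun_of i x = map_fun_of j y"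
      by (auto simp: image_of_def)
    then show "c \<in> map_fun_of i ` image_of p"
      using pullback_covers_fibre_product[OF assms, of x y] by (metis image_eqI image_of_def)
  qed
qed

lemma set_bicoveringsD:
  assumes "(i, j) \<in> set_bicoverings"
  shows "i \<in> Arr set_cat" "j \<in> Arr set_cat" "Cod set_cat j = Cod set_cat i"
    "inj_on (map_fun_of i) (Dom set_cat i)" "inj_on (map_fun_of j) (Dom set_cat j)"
    "image_of i \<union> image_of j = Cod set_cat i"
  using assms by (simp_all add: set_bicoverings_def is_cospan_def)

lemma set_bicoverings_swap: "(i, j) \<in> set_bicoverings \<Longrightarrow> (j, i) \<in> set_bicoverings"
  by (simp add: set_bicoverings_def is_cospan_def Un_commute)

text \<open>
  The preimage of the image of \<open>j\<close> under \<open>i\<close> serves as the pullback: a subset of the domain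
  of \<open>i\<close>, so it lives in the same type, which need not contain a product of the two domains.
\<close>

lemma set_bicovering_pullback:
  fixes i j :: "'u set_map"
  assumes "(i, j) \<in> set_bicoverings"
  shows "\<exists>p q. is_pullback set_cat i j p q"
proof -
  note ij = set_bicoveringsD[OF assms]
  define S where "S = {x \<in> Dom set_cat i. map_fun_of i x \<in> image_of j}"
  define q where "q = (\<lambda>x. inv_into (Dom set_cat j) (map_fun_of j) (map_fun_of i x))"
  have q: "q x \<in> Dom set_cat j" "map_fun_of j (q x) = map_fun_of i x" if "x \<in> S" for x
    using that inv_into_into[of "map_fun_of i x" "map_fun_of j" "Dom set_cat j"]
      f_inv_into_f[of "map_fun_of i x" "map_fun_of j" "Dom set_cat j"]
    by (simp_all add: S_def q_def image_of_def)
  let ?p = "(S, (\<lambda>x\<in>S. x), Dom set_cat i)" and ?q = "(S, (\<lambda>x\<in>S. q x), Dom set_cat j)"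
  have arr: "?p \<in> Arr set_cat" "?q \<in> Arr set_cat"
    using q by (auto simp: S_def)
  have "is_pullback set_cat i j ?p ?q"
    unfolding is_pullback_def
  proof (intro conjI allI impI)
    show "commuting_square set_cat i j ?p ?q"
      unfolding commuting_square_def is_cospan_def
      using ij arr q by (auto intro!: set_map_eqI Comp_in_Arr)
    fix p' q' :: "'u set_map"
    assume sq: "commuting_square set_cat i j p' q'"
    have p': "p' \<in> Arr set_cat" "q' \<in> Arr set_cat" "Dom set_cat q' = Dom set_cat p'"
      "Cod set_cat p' = Dom set_cat i" "Cod set_cat q' = Dom set_cat j"
      using sq by (simp_all add: commuting_square_def)
    note in_dom = commuting_square_apply(1,2)[OF sq] and comm = commuting_square_apply(3)[OF sq]
    have S: "map_fun_of p' w \<in> S" if "w \<in> Dom set_cat p'" for w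
      using that comm in_dom by (simp add: S_def image_of_def)
    have q'_eq: "q (map_fun_of p' w) = map_fun_of q' w" if "w \<in> Dom set_cat p'" for w
    proof (rule inj_onD[OF ij(5) _ q(1)[OF S] in_dom(2)])
      show "map_fun_of j (q (map_fun_of p' w)) = map_fun_of j (map_fun_of q' w)"
        using q(2)[OF S[OF that]] comm[OF that] by (rule trans)
    qed (rule that)+
    show "\<exists>!u. u \<in> hom set_cat (Dom set_cat p') (Dom set_cat ?p) \<and>
        Comp set_cat ?p u = p' \<and> Comp set_cat ?q u = q'"
    proof (rule ex1I)
      let ?u = "(Dom set_cat p', restrict (map_fun_of p') (Dom set_cat p'), S)"
      have u: "?u \<in> Arr set_cat"
        using S by auto
      have "Comp set_cat ?p ?u = p'" "Comp set_cat ?q ?u = q'"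
        using u arr p' S q'_eq Comp_in_Arr[OF u arr(1)] Comp_in_Arr[OF u arr(2)]
        by (auto intro!: set_map_eqI simp del: set_cat_simps(5))
      then show "?u \<in> hom set_cat (Dom set_cat p') (Dom set_cat ?p) \<and>
          Comp set_cat ?p ?u = p' \<and> Comp set_cat ?q ?u = q'"
        using u by (simp add: hom_def del: set_cat_simps(5))
      fix v
      assume v: "v \<in> hom set_cat (Dom set_cat p') (Dom set_cat ?p) \<and>
          Comp set_cat ?p v = p' \<and> Comp set_cat ?q v = q'"
      \<comment> \<open>The first projection is an inclusion, so it determines the mediating map.\<close>
      show "v = ?u"
      proof (rule set_map_eqI)
        show "v \<in> Arr set_cat" "Dom set_cat v = Dom set_cat ?u" "Cod set_cat v = Cod set_cat ?u"
          using v by (auto simp: hom_def)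
        show "?u \<in> Arr set_cat" by (rule u)
        fix w assume w: "w \<in> Dom set_cat v"
        then have "map_fun_of v w \<in> S"
          using v map_fun_of_in_Cod[of v w] by (auto simp: hom_def)
        then have "map_fun_of (Comp set_cat ?p v) w = map_fun_of v w"
          using w by simp
        then show "map_fun_of v w = map_fun_of ?u w"
          using v w by (auto simp: hom_def)
      qed
    qed
  qed
  then show ?thesis by blast
qed

text \<open>
  With \<open>A\<close>, \<open>A'\<close>, \<open>B\<close> the images of \<open>i\<close>, \<open>i \<circ> k\<close>, \<open>j\<close>: points of \<open>A\<close> that are not in
  \<open>A'\<close> come from the pullback, hence lie in \<open>B\<close>. This gives joint surjectivity of the composed
  bicovering and is the geometric content of the back-and-forth law.
\<close>

lemma image_of_bicovered_leg:
  assumes pb: "is_pullback set_cat i j p q" and kp: "(k, p) \<in> set_bicoverings"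
  shows "image_of i = image_of (Comp set_cat i k) \<union> (image_of i \<inter> image_of j)"
proof -
  have "Cod set_cat p = Dom set_cat i"
    using pb by (simp add: is_pullback_def commuting_square_def)
  then have "Dom set_cat i = image_of k \<union> image_of p"
    using set_bicoveringsD(3,6)[OF kp] by simp
  then have "image_of i = map_fun_of i ` (image_of k \<union> image_of p)"
    unfolding image_of_def[of i] by (rule arg_cong)
  then show ?thesis
    unfolding image_Un image_of_Comp image_of_pullback[OF pb] .
qed

lemma set_bicoverings_compose:
  assumes ij: "(i, j) \<in> set_bicoverings" and pb: "is_pullback set_cat i j p q"
    and kp: "(k, p) \<in> set_bicoverings"
  shows "(Comp set_cat i k, j) \<in> set_bicoverings"
proof -
  note ij' = set_bicoveringsD[OF ij] and kp' = set_bicoveringsD[OF kp]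
  have cod: "Cod set_cat k = Dom set_cat i"
    using pb kp'(3) by (simp add: is_pullback_def commuting_square_def)
  have "map_fun_of k ` Dom set_cat k \<subseteq> Dom set_cat i"
    using map_fun_of_in_Cod[OF kp'(1)] cod by auto
  then have "inj_on (map_fun_of i \<circ> map_fun_of k) (Dom set_cat k)"
    using ij'(4) kp'(4) by (blast intro: comp_inj_on inj_on_subset)
  then have "inj_on (map_fun_of (Comp set_cat i k)) (Dom set_cat k)"
    by (simp add: inj_on_def)
  moreover have "image_of (Comp set_cat i k) \<union> image_of j = Cod set_cat i"
    using image_of_bicovered_leg[OF pb kp] ij'(6) by blast
  ultimately show ?thesis
    using ij'(1,2,3,5) kp'(1) cod by (simp add: set_bicoverings_def is_cospan_def Comp_in_Arr)
qed

section \<open>Metrics on the sides of a bicovering\<close>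

lemma metrics_iff:
  "d \<in> metrics symm A \<longleftrightarrow> d \<in> extensional (A \<times> A) \<and> distance_on symm A (\<lambda>x y. d (x, y))"
  by (auto simp: metrics_def distance_on_def)

lemma distance_on_map:
  "distance_on symm B d \<Longrightarrow> f ` A \<subseteq> B \<Longrightarrow> distance_on symm A (\<lambda>x y. d (f x) (f y))"
  unfolding distance_on_def by (simp add: image_subset_iff)

lemma distance_on_agree:
  assumes "distance_on symm A d" and "\<And>x y. x \<in> A \<Longrightarrow> y \<in> A \<Longrightarrow> e x y = d x y"
  shows "distance_on symm A e"
  using assms(1) unfolding distance_on_def by (simp add: assms(2))

lemma metric_res_apply [simp]:
  "x \<in> Dom set_cat m \<Longrightarrow> y \<in> Dom set_cat m \<Longrightarrow>
   metric_res m d (x, y) = d (map_fun_of m x, map_fun_of m y)"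
  by (simp add: metric_res_def)

lemma metric_res_extensional: "metric_res m d \<in> extensional (Dom set_cat m \<times> Dom set_cat m)"
  by (simp add: metric_res_def)

lemma metric_res_in_metrics:
  assumes "m \<in> Arr set_cat" "d \<in> metrics symm (Cod set_cat m)"
  shows "metric_res m d \<in> metrics symm (Dom set_cat m)"
proof -
  have "distance_on symm (Cod set_cat m) (\<lambda>x y. d (x, y))"
    using assms(2) by (simp add: metrics_iff)
  then have "distance_on symm (Dom set_cat m) (\<lambda>x y. d (map_fun_of m x, map_fun_of m y))"
    by (rule distance_on_map) (use map_fun_of_in_Cod[OF assms(1)] in auto)
  then have "distance_on symm (Dom set_cat m) (\<lambda>x y. metric_res m d (x, y))"
    by (rule distance_on_agree) simp
  then show ?thesis
    by (simp add: metrics_iff metric_res_extensional)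
qed

lemma on_image_apply:
  "inj_on (map_fun_of i) (Dom set_cat i) \<Longrightarrow> x \<in> Dom set_cat i \<Longrightarrow> y \<in> Dom set_cat i \<Longrightarrow>
   on_image i d (map_fun_of i x) (map_fun_of i y) = d (x, y)"
  by (simp add: on_image_def)

lemma on_image_res:
  "x \<in> image_of i \<Longrightarrow> y \<in> image_of i \<Longrightarrow> on_image i (metric_res i d) x y = d (x, y)"
  by (simp add: on_image_def image_of_def inv_into_into f_inv_into_f)

lemma distance_on_image:
  assumes "d \<in> metrics symm (Dom set_cat i)"
  shows "distance_on symm (image_of i) (on_image i d)"
proof -
  have "distance_on symm (Dom set_cat i) (\<lambda>x y. d (x, y))"
    using assms by (simp add: metrics_iff)
  then show ?thesis
    unfolding on_image_def image_of_def by (rule distance_on_map) (auto intro: inv_into_into)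
qed

text \<open>
  This brings the gluing of two distances on overlapping sets to bear on bicoverings. Every point
  of the overlap comes from a point \<open>w\<close> of any pullback, and compatibility compares the two
  metrics exactly at such points.
\<close>

lemma compatible_pairs_overlap:
  assumes ij: "(i, j) \<in> set_bicoverings"
    and xy: "(d, e) \<in> compatible_pairs set_cat (metrics symm) metric_res i j"
  shows "overlapping_distances symm (image_of i) (image_of j) (on_image i d) (on_image j e)"
proof
  note ij' = set_bicoveringsD[OF ij]
  show "distance_on symm (image_of i) (on_image i d)" "distance_on symm (image_of j) (on_image j e)"
    using xy by (auto simp: compatible_pairs_def intro!: distance_on_image)
  obtain p q where pb: "is_pullback set_cat i j p q"
    using set_bicovering_pullback[OF ij] by blast
  then have res_eq: "metric_res p d = metric_res q e"
    using xy unfolding compatible_pairs_def by blast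
  have dom: "Dom set_cat q = Dom set_cat p"
    using pb by (simp add: is_pullback_def commuting_square_def)
  have pre: "\<exists>w \<in> Dom set_cat p. c = map_fun_of i (map_fun_of p w)"
    if "c \<in> image_of i" "c \<in> image_of j" for c
    using image_of_pullback[OF pb] that by (auto simp: image_of_def)
  fix x y
  assume "x \<in> image_of i" "x \<in> image_of j" "y \<in> image_of i" "y \<in> image_of j"
  then obtain v w where v: "v \<in> Dom set_cat p" "x = map_fun_of i (map_fun_of p v)"
    and w: "w \<in> Dom set_cat p" "y = map_fun_of i (map_fun_of p w)"
    using pre by blast
  have "on_image i d x y = d (map_fun_of p v, map_fun_of p w)"
    using v w pullback_commutes(1)[OF pb] ij'(4) by (simp add: on_image_apply)
  also have "\<dots> = e (map_fun_of q v, map_fun_of q w)"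
    using fun_cong[OF res_eq, of "(v, w)"] v w dom by simp
  also have "\<dots> = on_image j e x y"
    using v w pullback_commutes(2,3)[OF pb] ij'(5) by (simp add: on_image_apply)
  finally show "on_image i d x y = on_image j e x y" .
qed

lemma inf_through_eq:
  "inf_through i j d e = through (image_of i \<inter> image_of j) (on_image i d) (on_image j e)"
  by (simp add: fun_eq_iff inf_through_def through_def)

lemma metric_glue_eq:
  "metric_glue i j (d, e) = (\<lambda>(x, z) \<in> Cod set_cat i \<times> Cod set_cat i.
     glued (image_of i) (image_of j) (on_image i d) (on_image j e) x z)"
  by (auto simp: fun_eq_iff metric_glue_def glued_def inf_through_eq Int_commute restrict_def)

lemma metric_glue_apply:
  "x \<in> Cod set_cat i \<Longrightarrow> z \<in> Cod set_cat i \<Longrightarrow>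
   metric_glue i j (d, e) (x, z) =
   glued (image_of i) (image_of j) (on_image i d) (on_image j e) x z"
  by (simp add: metric_glue_eq)

lemma metric_glue_extensional:
  "metric_glue i j xy \<in> extensional (Cod set_cat i \<times> Cod set_cat i)"
  by (cases xy) (simp add: metric_glue_eq)

lemma extensional_pairs_eqI:
  assumes "d \<in> extensional (A \<times> A)" "e \<in> extensional (A \<times> A)"
    and "\<And>x z. x \<in> A \<Longrightarrow> z \<in> A \<Longrightarrow> d (x, z) = e (x, z)"
  shows "d = e"
  using assms by (auto intro: extensionalityI)

section \<open>The gleaf laws\<close>

lemma metric_glue_in_metrics:
  assumes ij: "(i, j) \<in> set_bicoverings"
    and xy: "xy \<in> compatible_pairs set_cat (metrics symm) metric_res i j"
  shows "metric_glue i j xy \<in> metrics symm (Cod set_cat i)"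
proof -
  obtain d e where de: "xy = (d, e)" by fastforce
  interpret overlapping_distances symm "image_of i" "image_of j" "on_image i d" "on_image j e"
    using compatible_pairs_overlap ij xy de by blast
  show ?thesis
    unfolding metrics_iff de
  proof
    show "metric_glue i j (d, e) \<in> extensional (Cod set_cat i \<times> Cod set_cat i)"
      by (rule metric_glue_extensional)
    show "distance_on symm (Cod set_cat i) (\<lambda>x z. metric_glue i j (d, e) (x, z))"
      using glued_distance unfolding set_bicoveringsD(6)[OF ij]
      by (rule distance_on_agree) (rule metric_glue_apply)
  qed
qed

lemma metric_glue_swap:
  assumes ij: "(i, j) \<in> set_bicoverings"
    and de: "(d, e) \<in> compatible_pairs set_cat (metrics symm) metric_res i j"
  shows "metric_glue j i (e, d) = metric_glue i j (d, e)"
proof -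
  interpret overlapping_distances symm "image_of i" "image_of j" "on_image i d" "on_image j e"
    using compatible_pairs_overlap[OF ij de] .
  note ij' = set_bicoveringsD(3,6)[OF ij]
  show ?thesis
  proof (rule extensional_pairs_eqI)
    show "metric_glue j i (e, d) \<in> extensional (Cod set_cat i \<times> Cod set_cat i)"
      using metric_glue_extensional[of j i] ij' by metis
    show "metric_glue i j (d, e) \<in> extensional (Cod set_cat i \<times> Cod set_cat i)"
      by (rule metric_glue_extensional)
  qed (use ij' glued_flip in \<open>simp add: metric_glue_apply\<close>)
qed

lemma metric_glue_identity_left:
  assumes "d \<in> metrics symm A"
  shows "metric_glue (Ident set_cat A) j (d, e) = d"
proof (rule extensional_pairs_eqI)
  have im: "image_of (Ident set_cat A) = A"
    by (auto simp: image_of_def)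
  show "metric_glue (Ident set_cat A) j (d, e) \<in> extensional (A \<times> A)"
    using metric_glue_extensional[of "Ident set_cat A"] by simp
  show "d \<in> extensional (A \<times> A)"
    using assms by (simp add: metrics_iff)
  fix x z assume "x \<in> A" "z \<in> A"
  then show "metric_glue (Ident set_cat A) j (d, e) (x, z) = d (x, z)"
    using on_image_apply[of "Ident set_cat A" x z d] im
    by (simp add: metric_glue_apply glued_def inj_on_def)
qed

text \<open>
  Write \<open>A\<close>, \<open>A'\<close>, \<open>B\<close> for the images of \<open>i\<close>, \<open>i \<circ> k\<close>, \<open>j\<close> and \<open>m\<close> for the metric glued
  from \<open>A'\<close> and \<open>B\<close>. For \<open>x \<in> A\<close> and \<open>z \<in> B\<close> it has to be shown that passing through
  \<open>A \<inter> B\<close> costs at most \<open>m x z\<close>. If \<open>x \<in> B\<close>, pass through \<open>x\<close>. Otherwise \<open>x \<in> A'\<close>, and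
  then \<open>m x z\<close> is by construction the cost of passing through the smaller set \<open>A' \<inter> B\<close>.
\<close>

lemma metric_glue_back_and_forth:
  assumes ij: "(i, j) \<in> set_bicoverings" and pb: "is_pullback set_cat i j p q"
    and kp: "(k, p) \<in> set_bicoverings"
    and xy: "xy \<in> compatible_pairs set_cat (metrics symm) metric_res (Comp set_cat i k) j"
  shows "metric_glue i j
      (metric_res i (metric_glue (Comp set_cat i k) j xy),
       metric_res j (metric_glue (Comp set_cat i k) j xy))
    = metric_glue (Comp set_cat i k) j xy" (is "metric_glue i j (metric_res i ?m, _) = _")
proof (rule extensional_pairs_eqI)
  let ?A = "image_of i" and ?A' = "image_of (Comp set_cat i k)" and ?B = "image_of j"
  note ij' = set_bicoveringsD[OF ij]
  have ikj: "(Comp set_cat i k, j) \<in> set_bicoverings"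
    using ij pb kp by (rule set_bicoverings_compose)
  obtain d e where de: "xy = (d, e)" by fastforce
  interpret overlapping_distances symm ?A' ?B "on_image (Comp set_cat i k) d" "on_image j e"
    using compatible_pairs_overlap ikj xy de by blast
  have A: "?A = ?A' \<union> (?A \<inter> ?B)"
    using pb kp by (rule image_of_bicovered_leg)
  have m: "?m (x, z) = glued ?A' ?B (on_image (Comp set_cat i k) d) (on_image j e) x z"
    if "x \<in> Cod set_cat i" "z \<in> Cod set_cat i" for x z
    using that de by (simp add: metric_glue_apply)
  have sub: "?A \<subseteq> Cod set_cat i" "?A' \<subseteq> Cod set_cat i" "?B \<subseteq> Cod set_cat i"
    using A ij'(6) by blast+
  have dist: "distance_on symm (?A \<union> ?B) (\<lambda>x z. ?m (x, z))"
    using metric_glue_in_metrics[OF ikj xy] ij'(6) by (simp add: metrics_iff)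
  show "metric_glue i j (metric_res i ?m, metric_res j ?m)
      \<in> extensional (Cod set_cat i \<times> Cod set_cat i)"
    by (rule metric_glue_extensional)
  show "?m \<in> extensional (Cod set_cat i \<times> Cod set_cat i)"
    using metric_glue_extensional[of "Comp set_cat i k"] by simp
  fix x z assume xz: "x \<in> Cod set_cat i" "z \<in> Cod set_cat i"
  have "metric_glue i j (metric_res i ?m, metric_res j ?m) (x, z)
      = glued ?A ?B (\<lambda>x z. ?m (x, z)) (\<lambda>x z. ?m (x, z)) x z"
    using xz ij'(6) by (simp add: metric_glue_apply) (intro glued_cong, auto simp: on_image_res)
  also have "\<dots> = ?m (x, z)"
  proof (rule glued_restrictions[OF dist])
    show "x \<in> ?A \<union> ?B" "z \<in> ?A \<union> ?B"
      using xz ij'(6) by auto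
  next
    fix x z assume x: "x \<in> ?A" and z: "z \<in> ?B"
    let ?m2 = "\<lambda>x z. ?m (x, z)"
    show "through (?A \<inter> ?B) ?m2 ?m2 x z \<le> ?m (x, z)"
    proof (cases "x \<in> ?B")
      case True
      then show ?thesis
        using through_le[of x "?A \<inter> ?B" ?m2 ?m2 x z] x distance_on_self[OF dist, of x] by simp
    next
      case False
      then have x': "x \<in> ?A'" using A x by blast
      have "through (?A \<inter> ?B) ?m2 ?m2 x z \<le> through (?A' \<inter> ?B) ?m2 ?m2 x z"
        using A by (intro through_antimono) blast
      also have "\<dots> = through (?A' \<inter> ?B) (on_image (Comp set_cat i k) d) (on_image j e) x z"
        using x' z sub by (intro through_cong) (auto simp: m subset_iff glued_left glued_right)
      also have "\<dots> = ?m (x, z)"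
        using x' z sub by (simp add: m subset_iff glued_left_right)
      finally show ?thesis .
    qed
  next
    fix x z assume x: "x \<in> ?B" and z: "z \<in> ?A"
    let ?m2 = "\<lambda>x z. ?m (x, z)"
    show "through (?A \<inter> ?B) ?m2 ?m2 x z \<le> ?m (x, z)"
    proof (cases "z \<in> ?B")
      case True
      then show ?thesis
        using through_le[of z "?A \<inter> ?B" ?m2 ?m2 x z] z distance_on_self[OF dist, of z] by simp
    next
      case False
      then have z': "z \<in> ?A'" using A z by blast
      have "through (?A \<inter> ?B) ?m2 ?m2 x z \<le> through (?A' \<inter> ?B) ?m2 ?m2 x z"
        using A by (intro through_antimono) blast
      also have "\<dots> = through (?A' \<inter> ?B) (on_image j e) (on_image (Comp set_cat i k) d) x z"
        using z' x sub by (intro through_cong) (auto simp: m subset_iff glued_left glued_right)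
      also have "\<dots> = ?m (x, z)"
        using z' x sub by (simp add: m subset_iff glued_right_left)
      finally show ?thesis .
    qed
  qed
  finally show "metric_glue i j (metric_res i ?m, metric_res j ?m) (x, z) = ?m (x, z)" .
qed

lemma bicovering_morphism_leg:
  assumes "qa \<in> hom set_cat (Dom set_cat i') (Dom set_cat i)"
    and "Comp set_cat qc i' = Comp set_cat i qa" "x \<in> Dom set_cat i'"
  shows "map_fun_of qa x \<in> Dom set_cat i"
    "map_fun_of qc (map_fun_of i' x) = map_fun_of i (map_fun_of qa x)"
  using assms map_fun_of_in_Cod[of qa x] map_fun_of_Comp_eqD[OF assms(2), of x]
  by (auto simp: hom_def)

lemma on_image_res_leg:
  assumes "inj_on (map_fun_of i') (Dom set_cat i')" "inj_on (map_fun_of i) (Dom set_cat i)"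
    and qa: "qa \<in> hom set_cat (Dom set_cat i') (Dom set_cat i)"
      "Comp set_cat qc i' = Comp set_cat i qa"
    and "x \<in> image_of i'" "z \<in> image_of i'"
  shows "on_image i' (metric_res qa d) x z = on_image i d (map_fun_of qc x) (map_fun_of qc z)"
proof -
  from assms(5,6) obtain x' z' where "x' \<in> Dom set_cat i'" "x = map_fun_of i' x'"
    "z' \<in> Dom set_cat i'" "z = map_fun_of i' z'"
    by (auto simp: image_of_def)
  then show ?thesis
    using assms(1,2) qa(1) bicovering_morphism_leg[OF qa]
    by (simp add: on_image_apply hom_def)
qed

lemma image_of_leg:
  assumes "qa \<in> hom set_cat (Dom set_cat i') (Dom set_cat i)"
    and "Comp set_cat qc i' = Comp set_cat i qa"
  shows "map_fun_of qc ` image_of i' \<subseteq> image_of i"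
  using bicovering_morphism_leg[OF assms] by (auto simp: image_of_def)

text \<open>
  For surjectivity, a point of the overlap downstairs comes from some \<open>w\<close> in the pullback
  there; the section \<open>s\<close> lifts \<open>w\<close> to the pullback upstairs, and the image of \<open>s w\<close> in
  the overlap upstairs is mapped back to the given point.
\<close>

lemma bicovering_morphism_overlap:
  assumes mor: "bicovering_morphism set_cat i' j' i j qa qb qc"
  shows "map_fun_of qc ` (image_of i' \<inter> image_of j') = image_of i \<inter> image_of j"
proof
  have q: "qa \<in> hom set_cat (Dom set_cat i') (Dom set_cat i)"
      "qb \<in> hom set_cat (Dom set_cat j') (Dom set_cat j)"
      "Comp set_cat qc i' = Comp set_cat i qa" "Comp set_cat qc j' = Comp set_cat j qb"
    using mor by (auto simp: bicovering_morphism_def)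
  show "map_fun_of qc ` (image_of i' \<inter> image_of j') \<subseteq> image_of i \<inter> image_of j"
    using image_of_leg q by blast
  from mor obtain p' q' p q u s where
    pb': "is_pullback set_cat i' j' p' q'" and pb: "is_pullback set_cat i j p q"
    and u: "u \<in> hom set_cat (Dom set_cat p') (Dom set_cat p)"
      "Comp set_cat p u = Comp set_cat qa p'"
    and s: "s \<in> hom set_cat (Dom set_cat p) (Dom set_cat p')"
      "Comp set_cat u s = Ident set_cat (Dom set_cat p)"
    unfolding bicovering_morphism_def by blast
  show "image_of i \<inter> image_of j \<subseteq> map_fun_of qc ` (image_of i' \<inter> image_of j')"
  proof
    fix c assume "c \<in> image_of i \<inter> image_of j"
    then obtain w where w: "w \<in> Dom set_cat p" "c = map_fun_of i (map_fun_of p w)"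
      using image_of_pullback[OF pb] by (auto simp: image_of_def)
    let ?w = "map_fun_of s w"
    have sw: "?w \<in> Dom set_cat p'"
      using s(1) w(1) map_fun_of_in_Cod[of s w] by (simp add: hom_def)
    have usw: "map_fun_of u ?w = w"
      using arg_cong[OF s(2), of "\<lambda>m. map_fun_of m w"] w(1) s(1) by (simp add: hom_def)
    let ?c = "map_fun_of i' (map_fun_of p' ?w)"
    have "map_fun_of qc ?c = map_fun_of i (map_fun_of qa (map_fun_of p' ?w))"
      using pullback_commutes(1)[OF pb' sw] by (rule bicovering_morphism_leg(2)[OF q(1,3)])
    also have "\<dots> = map_fun_of i (map_fun_of p (map_fun_of u ?w))"
      using map_fun_of_Comp_eqD[OF u(2), of ?w] sw u(1) by (simp add: hom_def)
    also have "\<dots> = c"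
      using usw w by simp
    finally have "c = map_fun_of qc ?c" ..
    moreover have "?c \<in> image_of i' \<inter> image_of j'"
      using image_of_pullback[OF pb'] sw by (auto simp: image_of_def)
    ultimately show "c \<in> map_fun_of qc ` (image_of i' \<inter> image_of j')"
      by (rule image_eqI)
  qed
qed

lemma metric_glue_partial_naturality:
  assumes ij': "(i', j') \<in> set_bicoverings" and ij: "(i, j) \<in> set_bicoverings"
    and mor: "bicovering_morphism set_cat i' j' i j qa qb qc"
    and de: "(d, e) \<in> compatible_pairs set_cat (metrics symm) metric_res i j"
  shows "metric_res qc (metric_glue i j (d, e))
    = metric_glue i' j' (metric_res qa d, metric_res qb e)"
proof (rule extensional_pairs_eqI)
  interpret overlapping_distances symm "image_of i" "image_of j" "on_image i d" "on_image j e"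
    using compatible_pairs_overlap[OF ij de] .
  note bc' = set_bicoveringsD[OF ij'] and bc = set_bicoveringsD[OF ij]
  have q: "qa \<in> hom set_cat (Dom set_cat i') (Dom set_cat i)"
      "qb \<in> hom set_cat (Dom set_cat j') (Dom set_cat j)"
      "qc \<in> hom set_cat (Cod set_cat i') (Cod set_cat i)"
      "Comp set_cat qc i' = Comp set_cat i qa" "Comp set_cat qc j' = Comp set_cat j qb"
    using mor by (auto simp: bicovering_morphism_def)
  have qc: "Dom set_cat qc = Cod set_cat i'"
    using q(3) by (simp add: hom_def)
  show "metric_res qc (metric_glue i j (d, e)) \<in> extensional (Cod set_cat i' \<times> Cod set_cat i')"
    using metric_res_extensional qc by metis
  show "metric_glue i' j' (metric_res qa d, metric_res qb e)
      \<in> extensional (Cod set_cat i' \<times> Cod set_cat i')"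
    by (rule metric_glue_extensional)
  fix x z assume x: "x \<in> Cod set_cat i'" and z: "z \<in> Cod set_cat i'"
  let ?f = "map_fun_of qc"
  have f: "?f x \<in> Cod set_cat i" "?f z \<in> Cod set_cat i"
    using q(3) x z map_fun_of_in_Cod[of qc] by (auto simp: hom_def)
  have "metric_glue i' j' (metric_res qa d, metric_res qb e) (x, z)
      = glued (image_of i') (image_of j') (\<lambda>x z. on_image i d (?f x) (?f z))
          (\<lambda>x z. on_image j e (?f x) (?f z)) x z"
    using x z bc bc' q
    by (simp add: metric_glue_apply) (intro glued_cong, auto simp: on_image_res_leg)
  also have "\<dots> = glued (image_of i) (image_of j) (on_image i d) (on_image j e) (?f x) (?f z)"
    using x z bc'(6) q
    by (intro glued_inverse_image bicovering_morphism_overlap[OF mor] image_of_leg) auto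
  also have "\<dots> = metric_res qc (metric_glue i j (d, e)) (x, z)"
    using x z f qc by (simp add: metric_glue_apply)
  finally show "metric_res qc (metric_glue i j (d, e)) (x, z)
      = metric_glue i' j' (metric_res qa d, metric_res qb e) (x, z)" ..
qed

lemma metric_glue_consistent: "metric_glue_consistent symm TYPE('u)"
proof -
  have "(x \<in> image_of i \<and> z \<in> image_of i \<longrightarrow>
           metric_glue i j (d, e) (x, z) = on_image i d x z) \<and>
        (x \<in> image_of i \<and> z \<in> image_of j \<longrightarrow>
           metric_glue i j (d, e) (x, z) = inf_through i j d e x z) \<and>
        (x \<in> image_of j \<and> z \<in> image_of i \<longrightarrow>
           metric_glue i j (d, e) (x, z) = inf_through j i e d x z) \<and>
        (x \<in> image_of j \<and> z \<in> image_of j \<longrightarrow>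
           metric_glue i j (d, e) (x, z) = on_image j e x z)"
    if ij: "(i, j) \<in> set_bicoverings"
      and de: "(d, e) \<in> compatible_pairs set_cat (metrics symm) metric_res i j"
    for i j :: "'u set_map" and d e x z
  proof -
    interpret overlapping_distances symm "image_of i" "image_of j" "on_image i d" "on_image j e"
      using compatible_pairs_overlap[OF ij de] .
    have "image_of i \<subseteq> Cod set_cat i" "image_of j \<subseteq> Cod set_cat i"
      using set_bicoveringsD(6)[OF ij] by auto
    then show ?thesis
      by (auto simp: metric_glue_apply subset_iff inf_through_eq Int_commute
          glued_left glued_right glued_left_right glued_right_left)
  qed
  then show ?thesis
    unfolding metric_glue_consistent_def by blast
qed

theorem proposition5p1p1:
  fixes symm :: bool
  shows "gleaf (set_cat :: ('u set, 'u set_map) cat) set_bicoverings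
           (metrics symm) metric_res metric_glue
         \<and> metric_glue_consistent symm TYPE('u)"
proof
  show "gleaf (set_cat :: ('u set, 'u set_map) cat) set_bicoverings
      (metrics symm) metric_res metric_glue"
  proof
    fix i j p q k :: "'u set_map"
    show "(i, j) \<in> set_bicoverings \<Longrightarrow> is_cospan set_cat i j"
      by (simp add: set_bicoverings_def)
    show "(i, j) \<in> set_bicoverings \<Longrightarrow> (j, i) \<in> set_bicoverings"
      by (rule set_bicoverings_swap)
    show "(i, j) \<in> set_bicoverings \<Longrightarrow> \<exists>p q. is_pullback set_cat i j p q"
      by (rule set_bicovering_pullback)
    show "(i, j) \<in> set_bicoverings \<Longrightarrow> is_pullback set_cat i j p q \<Longrightarrow>
        (k, p) \<in> set_bicoverings \<Longrightarrow> (Comp set_cat i k, j) \<in> set_bicoverings"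
      by (rule set_bicoverings_compose)
  next
    fix f g :: "'u set_map" and a b c and d :: "'u \<times> 'u \<Rightarrow> ennreal"
    show "f \<in> hom set_cat a b \<Longrightarrow> d \<in> metrics symm b \<Longrightarrow> metric_res f d \<in> metrics symm a"
      using metric_res_in_metrics[of f d symm] by (auto simp: hom_def)
    show "d \<in> metrics symm a \<Longrightarrow> metric_res (Ident set_cat a) d = d"
      using metric_res_extensional[of "Ident set_cat a" d]
      by (auto simp: metrics_iff intro: extensional_pairs_eqI)
    show "metric_res (Comp set_cat g f) d = metric_res f (metric_res g d)"
      if "f \<in> hom set_cat a b" "g \<in> hom set_cat b c"
    proof (rule extensional_pairs_eqI)
      show "metric_res (Comp set_cat g f) d \<in> extensional (Dom set_cat f \<times> Dom set_cat f)"
        using metric_res_extensional[of "Comp set_cat g f" d] by simp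
      show "metric_res f (metric_res g d) \<in> extensional (Dom set_cat f \<times> Dom set_cat f)"
        by (rule metric_res_extensional)
    qed (use that map_fun_of_in_Cod[of f] in \<open>auto simp: hom_def\<close>)
  next
    fix i j k p q i' j' qa qb qc :: "'u set_map" and a :: "'u set"
      and d e :: "'u \<times> 'u \<Rightarrow> ennreal" and de
    show "(i, j) \<in> set_bicoverings \<Longrightarrow> de \<in> compatible_pairs set_cat (metrics symm) metric_res i j \<Longrightarrow>
        metric_glue i j de \<in> metrics symm (Cod set_cat i)"
      by (rule metric_glue_in_metrics)
    show "(i, j) \<in> set_bicoverings \<Longrightarrow>
        (d, e) \<in> compatible_pairs set_cat (metrics symm) metric_res i j \<Longrightarrow>
        metric_glue j i (e, d) = metric_glue i j (d, e)"
      by (rule metric_glue_swap)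
    show "(d, e) \<in> compatible_pairs set_cat (metrics symm) metric_res (Ident set_cat a) j \<Longrightarrow>
        metric_glue (Ident set_cat a) j (d, e) = d"
      by (rule metric_glue_identity_left[of _ symm]) (simp add: compatible_pairs_def)
    show "metric_glue i (Ident set_cat a) (d, e) = e"
      if bc: "(i, Ident set_cat a) \<in> set_bicoverings"
        and de: "(d, e) \<in> compatible_pairs set_cat (metrics symm) metric_res i (Ident set_cat a)"
    proof -
      have "metric_glue i (Ident set_cat a) (d, e) = metric_glue (Ident set_cat a) i (e, d)"
        using metric_glue_swap[OF bc de] ..
      also have "\<dots> = e"
        using de by (intro metric_glue_identity_left[of _ symm]) (simp add: compatible_pairs_def)
      finally show ?thesis .
    qed
    show "(i, j) \<in> set_bicoverings \<Longrightarrow> is_pullback set_cat i j p q \<Longrightarrow>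
        (k, p) \<in> set_bicoverings \<Longrightarrow>
        de \<in> compatible_pairs set_cat (metrics symm) metric_res (Comp set_cat i k) j \<Longrightarrow>
        metric_glue i j (metric_res i (metric_glue (Comp set_cat i k) j de),
          metric_res j (metric_glue (Comp set_cat i k) j de))
        = metric_glue (Comp set_cat i k) j de"
      by (rule metric_glue_back_and_forth)
    show "(i', j') \<in> set_bicoverings \<Longrightarrow> (i, j) \<in> set_bicoverings \<Longrightarrow>
        bicovering_morphism set_cat i' j' i j qa qb qc \<Longrightarrow>
        (d, e) \<in> compatible_pairs set_cat (metrics symm) metric_res i j \<Longrightarrow>
        metric_res qc (metric_glue i j (d, e))
        = metric_glue i' j' (metric_res qa d, metric_res qb e)"
      by (rule metric_glue_partial_naturality)
  qed
  show "metric_glue_consistent symm TYPE('u)"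
    by (rule metric_glue_consistent)
qed

end
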